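(* Let $n\geq 0$ and $k\geq1$ be integers and $a_1,\dots,a_k>0$ real numbers. For $J\subseteq\{1,\dots,k\}$ with $|J|=j$ write $\{1,\dots,k\}\setminus J=\{i_{j+1},\dots,i_k\}$; all summation indices $l_i$ range over nonnegative integers, and $A=a_1+\dots+a_k$. If $k\geq 2$ is even, then for all $x$ \[ \sum_{l_1+\dots+l_k=n}\binom{n}{l_1,\ldots,l_k} \frac{(a_1)_{l_1}\cdots(a_k)_{l_k}}{(A)_n}E_{l_1}(x)\cdots E_{l_k}(x) =\sum_{j=1}^k\frac{(-2)^j}{n+1}\sum_{|J|=j}\sum_{l_0+l_1+\dots+l_{k-j}=n+1}\binom{n+1}{l_0,\ldots,l_{k-j}} \frac{(a_{i_{j+1}})_{l_1}\cdots(a_{i_k})_{l_{k-j}}}{(A)_{n+1-l_0}} B_{l_0}(x)E_{l_1}(0)\cdots E_{l_{k-j}}(0), \] and if $k\geq 1$ is odd, then for all $x$ \[ \sum_{l_1+\dots+l_k=n}\binom{n}{l_1,\ldots,l_k} \frac{(a_1)_{l_1}\cdots(a_k)_{l_k}}{(A)_n}E_{l_1}(x)\cdots E_{l_k}(x) =\sum_{j=1}^k(-2)^{j-1}\sum_{|J|=j}\sum_{l_0+l_1+\dots+l_{k-j}=n}\binom{n}{l_0,\ldots,l_{k-j}} \frac{(a_{i_{j+1}})_{l_1}\cdots(a_{i_k})_{l_{k-j}}}{(A)_{n-l_0}} E_{l_0}(x)E_{l_1}(0)\cdots E_{l_{k-j}}(0). \]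
   Context: The Euler polynomials $E_n(x)$ are defined by $\frac{2e^{xz}}{e^z+1}=\sum_{n\ge0}E_n(x)\frac{z^n}{n!}$; the Bernoulli polynomials $B_n(x)$ by $\frac{ze^{xz}}{e^z-1}=\sum_{n\ge0}B_n(x)\frac{z^n}{n!}$. The Pochhammer symbol is $(z)_0=1$, $(z)_m=z(z+1)\cdots(z+m-1)$ for $m\ge1$. $\binom{m}{l_0,\dots,l_r}$ is the multinomial coefficient; $\sum_{|J|=j}$ runs over subsets $J\subseteq\{1,\dots,k\}$ of cardinality $j$. *)

theory Defs
  imports Complex_Main "HOL-Library.FuncSet" "HOL-Computational_Algebra.Formal_Power_Series"
begin

definition euler_poly :: "nat \<Rightarrow> 'a::field_char_0 \<Rightarrow> 'a" where
  "euler_poly n x = fact n * fps_nth (2 * fps_exp x / (fps_exp 1 + 1)) n"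

text \<open>The denominator below has vanishing constant term; division of formal power series
  over a field cancels the common factor \<open>fps_X\<close>, so this is the true quotient.\<close>

definition bernoulli_poly :: "nat \<Rightarrow> 'a::field_char_0 \<Rightarrow> 'a" where
  "bernoulli_poly n x = fact n * fps_nth (fps_X * fps_exp x / (fps_exp 1 - 1)) n"

text \<open>Families \<open>l\<close> of nonnegative integers indexed by \<open>I\<close> with sum \<open>n\<close>. Extensionality
  (\<open>l i = undefined\<close> outside \<open>I\<close>) makes each family occur exactly once.\<close>

definition weak_compositions :: "nat set \<Rightarrow> nat \<Rightarrow> (nat \<Rightarrow> nat) set" where
  "weak_compositions I n = {l \<in> I \<rightarrow>\<^sub>E UNIV. (\<Sum>i\<in>I. l i) = n}"

definition multinomial :: "nat set \<Rightarrow> nat \<Rightarrow> (nat \<Rightarrow> nat) \<Rightarrow> real" where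
  "multinomial I m l = fact m / (\<Prod>i\<in>I. fact (l i))"

text \<open>The enumeration \<open>{1..k} - J = {i\<^bsub>j+1\<^esub>, \<dots>, i\<^bsub>k\<^esub>}\<close>, where \<open>j = card J\<close>, in increasing
  order: \<open>compl_index k J r\<close> is \<open>i\<^bsub>r\<^esub>\<close>, for \<open>r\<close> from \<open>j + 1\<close> to \<open>k\<close>.\<close>

definition compl_index :: "nat \<Rightarrow> nat set \<Rightarrow> nat \<Rightarrow> nat" where
  "compl_index k J r = sorted_list_of_set ({1..k} - J) ! (r - card J - 1)"

end

theory Submission
  imports Defs
begin

text \<open>If \<open>(\<lambda>\<^sub>1, \<dots>, \<lambda>\<^sub>k)\<close> is Dirichlet distributed with parameters \<open>a\<^sub>1, \<dots>, a\<^sub>k\<close>, then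
  \<open>\<Prod>(a\<^sub>i)\<^bsub>l\<^sub>i\<^esub> / (A)\<^bsub>n\<^esub>\<close> is the expectation of \<open>\<Prod>\<lambda>\<^sub>i\<^bsup>l\<^sub>i\<^esup>\<close>, where \<open>n = \<Sum>l\<^sub>i\<close>. The left-hand side thus
  has the exponential generating function \<open>e\<^bsup>x z\<^esup> P\<close>, where \<open>P\<close> is the expectation of \<open>\<Prod>f\<^sub>i\<close>
  with \<open>f\<^sub>i = 2 / (exp (\<lambda>\<^sub>i z) + 1)\<close>. Since \<open>exp (\<lambda>\<^sub>i z) f\<^sub>i = 2 - f\<^sub>i\<close> and \<open>\<Sum>\<lambda>\<^sub>i = 1\<close>, one has
  \<open>e\<^bsup>z\<^esup> \<Prod>f\<^sub>i = \<Prod>(2 - f\<^sub>i)\<close>. Expanding over subsets \<open>J\<close> and solving for \<open>P\<close> divides by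
  \<open>e\<^bsup>z\<^esup> - 1\<close> for even \<open>k\<close> and by \<open>e\<^bsup>z\<^esup> + 1\<close> for odd \<open>k\<close>; this is where the Bernoulli and the Euler
  polynomials come from.

  No probability is needed: the expectation is multiplication of the coefficients of the \<open>i\<close>-th
  factor by \<open>(a\<^sub>i)\<^bsub>l\<^esub>\<close>, followed by division of those of the product by \<open>(A)\<^bsub>n\<^esub>\<close>, and
  \<open>\<Sum>\<lambda>\<^sub>i = 1\<close> becomes the statement that this operation commutes with factoring out exponentials.\<close>

section \<open>Weak compositions and coefficients of finite products\<close>

lemma sum_weak_compositions_insert:
  fixes h :: "(nat \<Rightarrow> nat) \<Rightarrow> 'b::comm_monoid_add"
  assumes "finite I" "i \<notin> I"
  shows "(\<Sum>l\<in>weak_compositions (insert i I) n. h l)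
       = (\<Sum>c=0..n. \<Sum>l\<in>weak_compositions I (n - c). h (l(i := c)))"
proof -
  have fin: "finite (weak_compositions I m)" for m
  proof (rule finite_subset)
    show "weak_compositions I m \<subseteq> I \<rightarrow>\<^sub>E {0..m}"
      using assms(1) by (auto simp: weak_compositions_def PiE_iff extensional_def intro: member_le_sum)
  qed (use assms in \<open>auto intro: finite_PiE\<close>)
  have "(\<Sum>c=0..n. \<Sum>l\<in>weak_compositions I (n - c). h (l(i := c)))
      = (\<Sum>(c, l)\<in>(SIGMA c:{0..n}. weak_compositions I (n - c)). h (l(i := c)))"
    by (rule sum.Sigma) (auto simp: fin)
  also have "\<dots> = (\<Sum>l\<in>weak_compositions (insert i I) n. h l)"
  proof (rule sum.reindex_bij_witness[where i = "\<lambda>l. (l i, l(i := undefined))"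
        and j = "\<lambda>(c, l). l(i := c)"], goal_cases)
    case (1 p)
    then show ?case using assms
      by (auto simp: weak_compositions_def PiE_iff extensional_def fun_eq_iff)
  next
    case (2 p)
    have "(\<Sum>x\<in>I. if x = i then c else l x) = (\<Sum>x\<in>I. l x)" for c and l :: "nat \<Rightarrow> nat"
      using assms(2) by (intro sum.cong) auto
    with 2 show ?case using assms
      by (auto simp: weak_compositions_def PiE_iff extensional_def fun_upd_def)
  next
    case (3 l)
    then show ?case by simp
  next
    case (4 l)
    have "(\<Sum>x\<in>I. if x = i then c else l x) = (\<Sum>x\<in>I. l x)" for c
      using assms(2) by (intro sum.cong) auto
    with 4 show ?case using assms
      by (auto simp: weak_compositions_def PiE_iff extensional_def fun_upd_def)
  next
    case (5 p)
    then show ?case by auto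
  qed
  finally show ?thesis by simp
qed

lemma fps_prod_nth_weak_compositions:
  fixes H :: "nat \<Rightarrow> 'a::comm_ring_1 fps"
  assumes "finite I"
  shows "fps_nth (\<Prod>i\<in>I. H i) n = (\<Sum>l\<in>weak_compositions I n. \<Prod>i\<in>I. fps_nth (H i) (l i))"
  using assms
proof (induction I arbitrary: n rule: finite_induct)
  case empty
  have "weak_compositions {} n = (if n = 0 then {\<lambda>_. undefined} else {})"
    by (auto simp: weak_compositions_def)
  then show ?case by simp
next
  case (insert i I)
  have "(\<Prod>x\<in>I. fps_nth (H x) (if x = i then c else l x)) = (\<Prod>x\<in>I. fps_nth (H x) (l x))"
    for c l using insert.hyps by (intro prod.cong) auto
  then show ?case using insert.hyps
    by (simp add: sum_weak_compositions_insert fps_mult_nth insert.IH sum_distrib_left)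
qed

section \<open>Pochhammer weights and exponential factors\<close>

definition poch_mult :: "'a::field_char_0 \<Rightarrow> 'a fps \<Rightarrow> 'a fps" where
  "poch_mult a g = Abs_fps (\<lambda>n. pochhammer a n * fps_nth g n)"

definition poch_div :: "'a::field_char_0 \<Rightarrow> 'a fps \<Rightarrow> 'a fps" where
  "poch_div a g = Abs_fps (\<lambda>n. fps_nth g n / pochhammer a n)"

lemma poch_mult_nth [simp]: "fps_nth (poch_mult a g) n = pochhammer a n * fps_nth g n"
  by (simp add: poch_mult_def)

lemma poch_div_nth [simp]: "fps_nth (poch_div a g) n = fps_nth g n / pochhammer a n"
  by (simp add: poch_div_def)

text \<open>The series \<open>(1 - x t)\<^bsup>-a\<^esup>\<close>.\<close>

definition neg_binomial_series :: "'a::field_char_0 \<Rightarrow> 'a \<Rightarrow> 'a fps" where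
  "neg_binomial_series x a = Abs_fps (\<lambda>n. pochhammer a n * x ^ n / fact n)"

lemma neg_binomial_series_nth [simp]:
  "fps_nth (neg_binomial_series x a) n = pochhammer a n * x ^ n / fact n"
  by (simp add: neg_binomial_series_def)

text \<open>Coefficientwise this is Vandermonde's convolution for rising factorials,
  \<open>pochhammer_binomial_sum\<close>.\<close>

lemma neg_binomial_series_add:
  "neg_binomial_series x (a + b) = neg_binomial_series x a * neg_binomial_series x b"
proof (rule fps_ext)
  fix n
  have "fps_nth (neg_binomial_series x a * neg_binomial_series x b) n
      = (\<Sum>i\<le>n. of_nat (n choose i) * pochhammer a i * pochhammer b (n - i) * (x ^ n / fact n))"
    unfolding fps_mult_nth atLeast0AtMost
  proof (intro sum.cong refl)
    fix i assume "i \<in> {..n}"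
    then have "x ^ n = x ^ i * x ^ (n - i)"
      by (simp flip: power_add)
    then show "fps_nth (neg_binomial_series x a) i * fps_nth (neg_binomial_series x b) (n - i)
        = of_nat (n choose i) * pochhammer a i * pochhammer b (n - i) * (x ^ n / fact n)"
      using \<open>i \<in> {..n}\<close> by (simp add: binomial_fact field_simps)
  qed
  then show "fps_nth (neg_binomial_series x (a + b)) n
      = fps_nth (neg_binomial_series x a * neg_binomial_series x b) n"
    by (simp add: pochhammer_binomial_sum sum_distrib_right sum_divide_distrib)
qed

lemma neg_binomial_series_0 [simp]: "neg_binomial_series x 0 = 1"
  by (rule fps_ext) (simp add: pochhammer_0_left)

lemma neg_binomial_series_sum:
  "neg_binomial_series x (\<Sum>i\<in>I. a i) = (\<Prod>i\<in>I. neg_binomial_series x (a i))"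
  by (induction I rule: infinite_finite_induct) (simp_all add: neg_binomial_series_add)

lemma neg_binomial_series_power:
  "neg_binomial_series x a ^ m = neg_binomial_series x (of_nat m * a)"
  by (induction m) (simp_all add: neg_binomial_series_add algebra_simps)

lemma fps_mult_compose_nth:
  fixes p h u :: "'a::comm_ring_1 fps"
  assumes "fps_nth u 0 = 0"
  shows "fps_nth (p * (h oo u)) n = (\<Sum>m=0..n. fps_nth h m * fps_nth (p * u ^ m) n)"
proof -
  \<comment> \<open>For \<open>m > n - i\<close> the power \<open>u ^ m\<close> has no coefficient
    at \<open>n - i\<close>, so the inner sum may run up to \<open>n\<close> for every
    \<open>i\<close>; then the sums can be swapped.\<close>
  have "fps_nth (p * (h oo u)) n
      = (\<Sum>i=0..n. \<Sum>m=0..n. fps_nth p i * (fps_nth h m * fps_nth (u ^ m) (n - i)))"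
    unfolding fps_mult_nth fps_compose_nth sum_distrib_left
    using startsby_zero_power_prefix[OF assms]
    by (intro sum.cong refl sum.mono_neutral_left) auto
  also have "\<dots> = (\<Sum>m=0..n. fps_nth h m * fps_nth (p * u ^ m) n)"
    by (subst sum.swap) (simp add: fps_mult_nth sum_distrib_left mult_ac)
  finally show ?thesis .
qed

text \<open>Umbrally, \<open>poch_mult a g\<close> replaces each \<open>y\<close> in an exponential generating function
  \<open>e\<^bsup>y t\<^esup>\<close> by \<open>(1 - y t)\<^bsup>-a\<^esup>\<close>, and
  \<open>1 - (x + y) t = (1 - x t) (1 - y t / (1 - x t))\<close>.\<close>

lemma poch_mult_exp:
  "poch_mult a (fps_exp x * g)
   = neg_binomial_series x a * (poch_mult a g oo (fps_X * neg_binomial_series x 1))"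
proof (rule fps_ext)
  fix n
  have *: "neg_binomial_series x a * (fps_X * neg_binomial_series x 1) ^ m
      = fps_X ^ m * neg_binomial_series x (a + of_nat m)" for m
    by (simp add: neg_binomial_series_power neg_binomial_series_add power_mult_distrib mult_ac)
  have "fps_nth (neg_binomial_series x a * (poch_mult a g oo (fps_X * neg_binomial_series x 1))) n
      = (\<Sum>m=0..n. pochhammer a m * fps_nth g m *
          (pochhammer (a + of_nat m) (n - m) * x ^ (n - m) / fact (n - m)))"
    by (subst fps_mult_compose_nth)
       (auto simp: * fps_X_power_mult_nth intro!: sum.cong)
  \<comment> \<open>The two Pochhammer symbols combine to \<open>pochhammer a n\<close>, free of
    \<open>m\<close>; what remains is the convolution of \<open>g\<close> with
    \<open>fps_exp x\<close>.\<close>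
  also have "\<dots> = (\<Sum>m=0..n. pochhammer a n * (fps_nth g m * (x ^ (n - m) / fact (n - m))))"
    by (intro sum.cong refl) (simp add: pochhammer_product[where z = a and n = n])
  also have "\<dots> = fps_nth (poch_mult a (g * fps_exp x)) n"
    by (simp add: fps_mult_nth sum_distrib_left)
  finally show "fps_nth (poch_mult a (fps_exp x * g)) n
      = fps_nth (neg_binomial_series x a * (poch_mult a g oo (fps_X * neg_binomial_series x 1))) n"
    by (simp add: mult.commute)
qed

text \<open>In \<open>poch_mult_exp\<close> the substituted series is the same for every
  \<open>a i\<close>. Hence the prefactors multiply to the one for \<open>A\<close>, the
  compositions merge into one, and \<open>poch_mult_exp\<close> can be read backwards with
  \<open>A\<close>.\<close>

lemma poch_div_prod_exp:
  fixes a :: "nat \<Rightarrow> 'a::field_char_0"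
  assumes A: "A = (\<Sum>i\<in>I. a i)" and nz: "\<And>n. pochhammer A n \<noteq> 0"
  shows "poch_div A (\<Prod>i\<in>I. poch_mult (a i) (fps_exp x * g i))
       = fps_exp x * poch_div A (\<Prod>i\<in>I. poch_mult (a i) (g i))"
proof -
  let ?u = "fps_X * neg_binomial_series x 1"
  have mult_div: "poch_mult A (poch_div A h) = h" and div_mult: "poch_div A (poch_mult A h) = h" for h
    by (rule fps_ext, simp add: nz)+
  have "(\<Prod>i\<in>I. poch_mult (a i) (fps_exp x * g i))
      = neg_binomial_series x A * ((\<Prod>i\<in>I. poch_mult (a i) (g i)) oo ?u)"
    by (simp add: poch_mult_exp prod.distrib A neg_binomial_series_sum fps_compose_prod_distrib)
  also have "\<dots> = poch_mult A (fps_exp x * poch_div A (\<Prod>i\<in>I. poch_mult (a i) (g i)))"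
    by (simp add: poch_mult_exp mult_div)
  finally show ?thesis by (simp add: div_mult)
qed

section \<open>The Euler and Bernoulli generating functions\<close>

definition euler_fps :: "complex fps" where
  "euler_fps = 2 / (fps_exp 1 + 1)"

lemma euler_fps_mult: "(fps_exp 1 + 1) * euler_fps = 2"
  unfolding euler_fps_def by (subst fps_divide_unit) (simp_all add: inverse_mult_eq_1' mult.left_commute)

lemma euler_poly_conv: "euler_poly n x = fact n * fps_nth (fps_exp x * euler_fps) n"
proof -
  have "2 * fps_exp x / (fps_exp 1 + 1) = fps_exp x * euler_fps"
    unfolding euler_fps_def by (simp add: fps_divide_unit mult_ac)
  then show ?thesis by (simp add: euler_poly_def)
qed

definition bernoulli_fps :: "complex \<Rightarrow> complex fps" where
  "bernoulli_fps x = fps_X * fps_exp x / (fps_exp 1 - 1)"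

lemma fps_exp_1_minus_1_nz: "fps_exp 1 - 1 \<noteq> (0 :: complex fps)"
proof
  assume "fps_exp 1 - 1 = (0 :: complex fps)"
  then have "fps_nth (fps_exp 1 - 1 :: complex fps) 1 = 0" by simp
  then show False by simp
qed

text \<open>The denominator has subdegree 1 and the numerator at least that, so the division is
  exact although the denominator is not a unit.\<close>

lemma bernoulli_fps_mult: "bernoulli_fps x * (fps_exp 1 - 1) = fps_X * fps_exp x"
proof -
  have "subdegree (fps_exp 1 - 1 :: complex fps) = 1"
    by (rule subdegreeI) auto
  moreover have "1 \<le> subdegree (fps_X * fps_exp x)"
    by (rule subdegree_geI) (auto simp: fps_eq_iff intro!: exI[of _ 1])
  ultimately have "(fps_exp 1 - 1) dvd (fps_X * fps_exp x)"
    using fps_exp_1_minus_1_nz by (auto simp: fps_dvd_iff)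
  then show ?thesis by (simp add: bernoulli_fps_def)
qed

section \<open>From indexed sums to power series coefficients\<close>

lemma bij_betw_compl_index:
  assumes "J \<subseteq> {1..k}" "card J = j"
  shows "bij_betw (\<lambda>m. compl_index k J (j + m)) {1..k-j} ({1..k} - J)"
proof -
  let ?xs = "sorted_list_of_set ({1..k} - J)"
  have "card ({1..k} - J) = k - j"
    using assms by (simp add: card_Diff_subset finite_subset)
  then have "bij_betw ((!) ?xs) {..<k-j} ({1..k} - J)"
    by (intro bij_betw_nth) auto
  \<comment> \<open>\<open>compl_index k J (j + m)\<close> is entry \<open>m - 1\<close> of the
    list, since \<open>(!)\<close> counts from 0.\<close>
  moreover have "bij_betw (\<lambda>m. m - 1) {1..k-j} {..<k-j}"
    by (rule bij_betw_byWitness[where f' = Suc]) auto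
  ultimately have "bij_betw ((!) ?xs \<circ> (\<lambda>m. m - 1)) {1..k-j} ({1..k} - J)"
    by (rule bij_betw_trans[rotated])
  then show ?thesis
    by (simp add: compl_index_def assms(2) comp_def)
qed

text \<open>\<open>F\<close> stays outside \<open>poch_div\<close>, so its index \<open>l 0\<close>
  does not count towards the Pochhammer denominator; hence \<open>N - l 0\<close>.\<close>

lemma fps_mult_poch_div_prod_nth:
  fixes F :: "'a::field_char_0 fps"
  shows "fps_nth (F * poch_div A (\<Prod>i=1..m. H i)) N
    = (\<Sum>l\<in>weak_compositions {0..m} N.
        fps_nth F (l 0) * (\<Prod>i=1..m. fps_nth (H i) (l i)) / pochhammer A (N - l 0))"
proof -
  have "{0..m} = insert 0 {1..m}" by auto
  moreover have "(\<Prod>i=1..m. fps_nth (H i) (if i = 0 then c else l i))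
      = (\<Prod>i=1..m. fps_nth (H i) (l i))" for c l
    by (intro prod.cong) auto
  ultimately show ?thesis
    by (simp add: sum_weak_compositions_insert fps_mult_nth fps_prod_nth_weak_compositions
        sum_distrib_left sum_divide_distrib)
qed

text \<open>The factorials in the multinomial coefficient cancel those that turn coefficients into
  polynomial values. \<open>F\<close> is left open to serve both the Bernoulli and the Euler
  case.\<close>

lemma sum_euler_products_eq:
  assumes J: "J \<subseteq> {1..k}" "card J = j"
  shows "(\<Sum>l\<in>weak_compositions {0..k-j} N.
            of_real (multinomial {0..k-j} N l
              * (\<Prod>m=1..k-j. pochhammer (a (compl_index k J (j + m))) (l m))
              / pochhammer A (N - l 0))
            * (fact (l 0) * fps_nth F (l 0)) * (\<Prod>m=1..k-j. euler_poly (l m) 0))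
       = fact N * fps_nth (F * poch_div (of_real A)
            (\<Prod>i\<in>{1..k}-J. poch_mult (of_real (a i)) euler_fps)) N"
proof -
  have "(\<Prod>i\<in>{1..k}-J. poch_mult (complex_of_real (a i)) euler_fps)
      = (\<Prod>m=1..k-j. poch_mult (of_real (a (compl_index k J (j + m)))) euler_fps)"
    using prod.reindex_bij_betw[OF bij_betw_compl_index[OF J]] by (rule sym)
  moreover have "{0..k-j} = insert 0 {1..k-j}" by auto
  ultimately show ?thesis
    by (simp only: fps_mult_poch_div_prod_nth sum_distrib_left)
       (intro sum.cong refl, simp add: multinomial_def euler_poly_conv prod.distrib
          pochhammer_of_real field_simps)
qed

lemma sum_by_card:
  fixes c :: "nat \<Rightarrow> 'a::comm_ring_1"
  shows "(\<Sum>j=1..k. c j * (\<Sum>J | J \<subseteq> {1..k} \<and> card J = j. h J))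
       = (\<Sum>J\<in>Pow {1..k} - {{}}. c (card J) * h J)"
proof -
  have "(\<Sum>j=1..k. c j * (\<Sum>J | J \<subseteq> {1..k} \<and> card J = j. h J))
      = (\<Sum>j=1..k. \<Sum>J | J \<in> Pow {1..k} - {{}} \<and> card J = j. c (card J) * h J)"
    unfolding sum_distrib_left by (intro sum.cong refl) auto
  also have "\<dots> = (\<Sum>J\<in>Pow {1..k} - {{}}. c (card J) * h J)"
  proof (rule sum.group)
    have "1 \<le> card J \<and> card J \<le> k" if "J \<subseteq> {1..k}" "J \<noteq> {}" for J
      using that card_mono[OF _ that(1)] finite_subset[OF that(1)]
      by (auto simp: Suc_le_eq card_gt_0_iff)
    then show "card ` (Pow {1..k} - {{}}) \<subseteq> {1..k}"
      unfolding image_subset_iff atLeastAtMost_iff by blast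
  qed auto
  finally show ?thesis .
qed

section \<open>The functional equation\<close>

lemma exp_mult_poch_div_euler:
  fixes a :: "nat \<Rightarrow> complex"
  assumes "finite I" and "A = (\<Sum>i\<in>I. a i)" and "\<And>n. pochhammer A n \<noteq> 0"
  defines "G \<equiv> \<lambda>J. poch_div A (\<Prod>i\<in>I-J. poch_mult (a i) euler_fps)"
  shows "(-1) ^ card I * fps_exp 1 * G {} = G {} + (\<Sum>J\<in>Pow I - {{}}. (-2) ^ card J * G J)"
proof -
  \<comment> \<open>\<open>poch_mult b\<close> fixes the constant 2 because
    \<open>pochhammer b 0 = 1\<close>.\<close>
  have shift: "poch_mult b (fps_exp 1 * euler_fps) = - (- 2 + poch_mult b euler_fps)" for b
  proof -
    have "fps_exp 1 * euler_fps = 2 - euler_fps"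
      using euler_fps_mult by (simp add: algebra_simps)
    moreover have "poch_mult b (2 - euler_fps) = - (- 2 + poch_mult b euler_fps)"
      by (intro fps_ext) (simp add: algebra_simps fps_numeral_nth)
    ultimately show ?thesis by simp
  qed
  have pow: "(-2) ^ m = fps_const ((-2) ^ m :: complex)" for m
    by (simp add: numeral_fps_const flip: fps_const_power fps_const_neg)
  have sgn: "(-1) ^ m = fps_const ((-1) ^ m :: complex)" for m
    by (simp flip: fps_const_power fps_const_neg)
  have "fps_exp 1 * G {} = poch_div A (\<Prod>i\<in>I. poch_mult (a i) (fps_exp 1 * euler_fps))"
    unfolding G_def by (simp add: poch_div_prod_exp[OF assms(2,3)])
  also have "(\<Prod>i\<in>I. poch_mult (a i) (fps_exp 1 * euler_fps))
      = (-1) ^ card I * (\<Prod>i\<in>I. - 2 + poch_mult (a i) euler_fps)"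
    unfolding shift prod_uminus ..
  \<comment> \<open>\<open>J\<close> is the set of factors contributing \<open>- 2\<close>. The
    empty \<open>J\<close> gives back \<open>G {}\<close>, which is split off below so that the
    equation can be solved for it.\<close>
  also have "(\<Prod>i\<in>I. - 2 + poch_mult (a i) euler_fps)
      = (\<Sum>J\<in>Pow I. (-2) ^ card J * (\<Prod>i\<in>I-J. poch_mult (a i) euler_fps))"
    unfolding prod_add[OF assms(1)] prod_constant ..
  also have "poch_div A ((-1) ^ card I * \<dots>) = (-1) ^ card I * (\<Sum>J\<in>Pow I. (-2) ^ card J * G J)"
    by (intro fps_ext)
       (simp add: G_def pow sgn fps_sum_nth sum_divide_distrib sum_distrib_left mult_ac)
  finally have "(-1) ^ card I * (fps_exp 1 * G {})
      = ((-1) ^ card I * (-1) ^ card I) * (\<Sum>J\<in>Pow I. (-2) ^ card J * G J)"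
    by (simp add: mult.assoc)
  also have "(-1) ^ card I * (-1) ^ card I = (1 :: complex fps)"
    by (simp flip: power_mult_distrib)
  also have "(\<Sum>J\<in>Pow I. (-2) ^ card J * G J)
      = G {} + (\<Sum>J\<in>Pow I - {{}}. (-2) ^ card J * G J)"
    using assms(1) by (subst sum.remove[of _ "{}"]) auto
  finally show ?thesis by (simp add: mult.assoc)
qed

section \<open>Solving for \<open>G {}\<close> with \<open>k\<close> even and odd\<close>

theorem theorem4:
  fixes n k :: nat and a :: "nat \<Rightarrow> real" and A :: real
  assumes "k \<ge> 1"
    and "\<And>i. i \<in> {1..k} \<Longrightarrow> a i > 0"
    and "A = (\<Sum>i=1..k. a i)"
  shows
    "(k \<ge> 2 \<and> even k \<longrightarrow> (\<forall>x::complex.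
        (\<Sum>l\<in>weak_compositions {1..k} n.
           of_real (multinomial {1..k} n l * (\<Prod>i=1..k. pochhammer (a i) (l i)) / pochhammer A n)
           * (\<Prod>i=1..k. euler_poly (l i) x))
        = (\<Sum>j=1..k. (-2) ^ j / of_nat (n + 1) *
            (\<Sum>J | J \<subseteq> {1..k} \<and> card J = j.
              \<Sum>l\<in>weak_compositions {0..k-j} (n + 1).
                of_real (multinomial {0..k-j} (n + 1) l
                  * (\<Prod>m=1..k-j. pochhammer (a (compl_index k J (j + m))) (l m))
                  / pochhammer A (n + 1 - l 0))
                * bernoulli_poly (l 0) x * (\<Prod>m=1..k-j. euler_poly (l m) 0)))))
     \<and> (odd k \<longrightarrow> (\<forall>x::complex.
        (\<Sum>l\<in>weak_compositions {1..k} n.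
           of_real (multinomial {1..k} n l * (\<Prod>i=1..k. pochhammer (a i) (l i)) / pochhammer A n)
           * (\<Prod>i=1..k. euler_poly (l i) x))
        = (\<Sum>j=1..k. (-2) ^ (j - 1) *
            (\<Sum>J | J \<subseteq> {1..k} \<and> card J = j.
              \<Sum>l\<in>weak_compositions {0..k-j} n.
                of_real (multinomial {0..k-j} n l
                  * (\<Prod>m=1..k-j. pochhammer (a (compl_index k J (j + m))) (l m))
                  / pochhammer A (n - l 0))
                * euler_poly (l 0) x * (\<Prod>m=1..k-j. euler_poly (l m) 0)))))"
proof -
  define G where "G J = poch_div (complex_of_real A)
    (\<Prod>i\<in>{1..k}-J. poch_mult (complex_of_real (a i)) euler_fps)" for J
  have A: "complex_of_real A = (\<Sum>i\<in>{1..k}. of_real (a i))"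
    by (simp add: assms(3))
  have "A > 0"
    unfolding assms(3) using assms(1,2) by (intro sum_pos) auto
  then have nz: "pochhammer (complex_of_real A) m \<noteq> 0" for m
    using pochhammer_pos[of A m] by (simp add: pochhammer_of_real)
  have key: "(-1) ^ k * fps_exp 1 * G {}
      = G {} + (\<Sum>J\<in>Pow {1..k} - {{}}. (-2) ^ card J * G J)"
    using exp_mult_poch_div_euler[OF _ A nz] by (simp add: G_def)
  have pow: "fps_nth ((-2) ^ m * h) N = (-2) ^ m * fps_nth h N" for m N and h :: "complex fps"
  proof -
    have "(-2) ^ m = fps_const ((-2) ^ m :: complex)"
      by (simp add: numeral_fps_const flip: fps_const_power fps_const_neg)
    then show ?thesis by simp
  qed
  have lhs: "(\<Sum>l\<in>weak_compositions {1..k} n.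
           of_real (multinomial {1..k} n l * (\<Prod>i=1..k. pochhammer (a i) (l i)) / pochhammer A n)
           * (\<Prod>i=1..k. euler_poly (l i) x))
      = fact n * fps_nth (fps_exp x * G {}) n" for x :: complex
  proof -
    have "fps_exp x * G {} = poch_div (of_real A)
        (\<Prod>i\<in>{1..k}. poch_mult (of_real (a i)) (fps_exp x * euler_fps))"
      unfolding G_def Diff_empty by (rule poch_div_prod_exp[OF A nz, symmetric])
    then show ?thesis
      by (simp only: poch_div_nth fps_prod_nth_weak_compositions finite_atLeastAtMost
          sum_distrib_left sum_divide_distrib)
         (intro sum.cong refl, simp add: multinomial_def euler_poly_conv prod.distrib
            pochhammer_of_real field_simps)
  qed
  have rhs: "(\<Sum>j=1..k. c j *
            (\<Sum>J | J \<subseteq> {1..k} \<and> card J = j.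
              \<Sum>l\<in>weak_compositions {0..k-j} N.
                of_real (multinomial {0..k-j} N l
                  * (\<Prod>m=1..k-j. pochhammer (a (compl_index k J (j + m))) (l m))
                  / pochhammer A (N - l 0))
                * (fact (l 0) * fps_nth F (l 0)) * (\<Prod>m=1..k-j. euler_poly (l m) 0)))
      = (\<Sum>J\<in>Pow {1..k} - {{}}. c (card J) * (fact N * fps_nth (F * G J) N))"
    for c :: "nat \<Rightarrow> complex" and N F
    by (rule trans[OF _ sum_by_card], unfold G_def)
       (intro sum.cong refl arg_cong2[where f = "(*)"] sum_euler_products_eq, auto)
  show ?thesis
  proof (intro conjI impI allI)
    fix x :: complex
    assume "k \<ge> 2 \<and> even k"
    then have "(fps_exp 1 - 1) * G {} = (\<Sum>J\<in>Pow {1..k} - {{}}. (-2) ^ card J * G J)"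
      using key by (simp add: algebra_simps)
    \<comment> \<open>\<open>fps_exp 1 - 1\<close> is not invertible, only nonzero: it is produced
      on both sides and then cancelled.\<close>
    then have "(fps_exp 1 - 1) * (bernoulli_fps x * (\<Sum>J\<in>Pow {1..k} - {{}}. (-2) ^ card J * G J))
        = (fps_exp 1 - 1) * (fps_X * (fps_exp x * G {}))"
      using bernoulli_fps_mult[of x] by (metis (no_types, lifting) mult.assoc mult.commute)
    then have "fps_X * (fps_exp x * G {})
        = (\<Sum>J\<in>Pow {1..k} - {{}}. (-2) ^ card J * (bernoulli_fps x * G J))"
      unfolding mult_cancel_left using fps_exp_1_minus_1_nz by (simp add: sum_distrib_left mult_ac)
    \<comment> \<open>The factor \<open>fps_X\<close> shifts the index to \<open>n + 1\<close>;
      rewriting \<open>fact n\<close> as \<open>fact (n + 1) / (n + 1)\<close> gives the denominator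
      of the claim.\<close>
    then have "fps_nth (fps_X * (fps_exp x * G {})) (n + 1)
        = (\<Sum>J\<in>Pow {1..k} - {{}}. (-2) ^ card J * fps_nth (bernoulli_fps x * G J) (n + 1))"
      by (simp only: fps_sum_nth pow)
    then have "fact n * fps_nth (fps_exp x * G {}) n
        = (\<Sum>J\<in>Pow {1..k} - {{}}. (-2) ^ card J / of_nat (n + 1) *
            (fact (n + 1) * fps_nth (bernoulli_fps x * G J) (n + 1)))"
      by (simp add: sum_distrib_left mult_ac field_simps del: of_nat_Suc of_nat_add)
    then show "(\<Sum>l\<in>weak_compositions {1..k} n.
           of_real (multinomial {1..k} n l * (\<Prod>i=1..k. pochhammer (a i) (l i)) / pochhammer A n)
           * (\<Prod>i=1..k. euler_poly (l i) x))
        = (\<Sum>j=1..k. (-2) ^ j / of_nat (n + 1) *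
            (\<Sum>J | J \<subseteq> {1..k} \<and> card J = j.
              \<Sum>l\<in>weak_compositions {0..k-j} (n + 1).
                of_real (multinomial {0..k-j} (n + 1) l
                  * (\<Prod>m=1..k-j. pochhammer (a (compl_index k J (j + m))) (l m))
                  / pochhammer A (n + 1 - l 0))
                * bernoulli_poly (l 0) x * (\<Prod>m=1..k-j. euler_poly (l m) 0)))"
      unfolding lhs bernoulli_poly_def bernoulli_fps_def[symmetric] rhs .
  next
    fix x :: complex
    assume "odd k"
    then have "(fps_exp 1 + 1) * G {} = - (\<Sum>J\<in>Pow {1..k} - {{}}. (-2) ^ card J * G J)"
      using key by (simp add: neg_eq_iff_add_eq_0 eq_neg_iff_add_eq_0 algebra_simps)
    \<comment> \<open>Pulling out 2 lowers the exponent, which needs \<open>J\<close> nonempty. This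
      2 later cancels against the one in \<open>euler_fps_mult\<close>.\<close>
    also have "\<dots> = 2 * (\<Sum>J\<in>Pow {1..k} - {{}}. (-2) ^ (card J - 1) * G J)"
      unfolding sum_distrib_left sum_negf[symmetric]
    proof (intro sum.cong refl)
      fix J assume "J \<in> Pow {1..k} - {{}}"
      then have "card J \<noteq> 0" by (auto dest: finite_subset)
      then obtain m where "card J = Suc m" by (cases "card J") auto
      then show "- ((-2) ^ card J * G J) = 2 * ((-2) ^ (card J - 1) * G J)" by simp
    qed
    finally have "2 * (fps_exp x * G {})
        = 2 * (fps_exp x * euler_fps * (\<Sum>J\<in>Pow {1..k} - {{}}. (-2) ^ (card J - 1) * G J))"
      using euler_fps_mult by algebra
    then have "fps_exp x * G {}
        = (\<Sum>J\<in>Pow {1..k} - {{}}. (-2) ^ (card J - 1) * (fps_exp x * euler_fps * G J))"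
      unfolding mult_cancel_left by (simp add: sum_distrib_left mult_ac)
    then have "fact n * fps_nth (fps_exp x * G {}) n
        = (\<Sum>J\<in>Pow {1..k} - {{}}. (-2) ^ (card J - 1) *
            (fact n * fps_nth (fps_exp x * euler_fps * G J) n))"
      by (simp only: fps_sum_nth pow sum_distrib_left) (simp only: mult.left_commute[of "fact n"])
    then show "(\<Sum>l\<in>weak_compositions {1..k} n.
           of_real (multinomial {1..k} n l * (\<Prod>i=1..k. pochhammer (a i) (l i)) / pochhammer A n)
           * (\<Prod>i=1..k. euler_poly (l i) x))
        = (\<Sum>j=1..k. (-2) ^ (j - 1) *
            (\<Sum>J | J \<subseteq> {1..k} \<and> card J = j.
              \<Sum>l\<in>weak_compositions {0..k-j} n.
                of_real (multinomial {0..k-j} n l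
                  * (\<Prod>m=1..k-j. pochhammer (a (compl_index k J (j + m))) (l m))
                  / pochhammer A (n - l 0))
                * euler_poly (l 0) x * (\<Prod>m=1..k-j. euler_poly (l m) 0)))"
      unfolding lhs unfolding euler_poly_conv[of _ x] rhs .
  qed
qed

end
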